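(* Let $F\colon\mathbb{R}^n\rightrightarrows\mathbb{R}^n$ be a set-valued mapping whose graph is locally closed around a given point $(\bar x,\bar v)\in\mathrm{gph}\,F$. If $F$ is strongly metrically subregular at $(\bar x,\bar v)$, then there exists $d\in\mathbb{R}^n$ satisfying $$-\bar v\in D^*F(\bar x,\bar v)(d).$$
   Context: For $\Omega\subset\mathbb{R}^s$ and $\bar z\in\Omega$, the regular normal cone is $\widehat N_\Omega(\bar z)=\{v:\limsup_{z\to\bar z,\,z\in\Omega}\frac{\langle v,z-\bar z\rangle}{\|z-\bar z\|}\le 0\}$, and the limiting normal cone is $N_\Omega(\bar z)=\{v:\exists\, z_k\to\bar z,\ z_k\in\Omega,\ v_k\to v\text{ with }v_k\in\widehat N_\Omega(z_k)\}$. For $F\colon\mathbb{R}^n\rightrightarrows\mathbb{R}^m$, $\mathrm{gph}\,F=\{(x,y):y\in F(x)\}$, $F^{-1}(y)=\{x:y\in F(x)\}$, and for $(x,y)\in\mathrm{gph}\,F$ the limiting coderivative is $D^*F(x,y)(v)=\{u\in\mathbb{R}^n:(u,-v)\in N_{\mathrm{gph}\,F}(x,y)\}$, $v\in\mathbb{R}^m$. $F$ is metrically subregular at $(\bar x,\bar y)\in\mathrm{gph}\,F$ with modulus $\mu>0$ if there is a neighborhood $U$ of $\bar x$ with $\mathrm{dist}(x;F^{-1}(\bar y))\le\mu\,\mathrm{dist}(\bar y;F(x))$ for all $x\in U$ (distance to the empty set is $\infty$). If in addition $F^{-1}(\bar y)\cap U=\{\bar x\}$, then $F$ is strongly metrically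 subregular at $(\bar x,\bar y)$. *)

theory Defs
  imports "HOL-Analysis.Analysis"
begin

(* The filter "at z within S" excludes z itself, as in the usual reading of the quotient.
   At an isolated point of S it is the trivial filter, where Limsup is -\<infinity>, so that the
   cone is the whole space. *)
definition regular_normal_cone :: "'a::euclidean_space set \<Rightarrow> 'a \<Rightarrow> 'a set" where
  "regular_normal_cone S zbar =
     {v. Limsup (at zbar within S)
           (\<lambda>z. ereal (inner v (z - zbar) / norm (z - zbar))) \<le> 0}"

definition limiting_normal_cone :: "'a::euclidean_space set \<Rightarrow> 'a \<Rightarrow> 'a set" where
  "limiting_normal_cone S zbar =
     {v. \<exists>z w. (\<forall>k::nat. z k \<in> S \<and> w k \<in> regular_normal_cone S (z k)) \<and>
               z \<longlonglongrightarrow> zbar \<and> w \<longlonglongrightarrow> v}"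

definition gph :: "('a \<Rightarrow> 'b set) \<Rightarrow> ('a \<times> 'b) set" where
  "gph F = {(x, y). y \<in> F x}"

definition inv_map :: "('a \<Rightarrow> 'b set) \<Rightarrow> 'b \<Rightarrow> 'a set" where
  "inv_map F y = {x. y \<in> F x}"

definition limiting_coderivative ::
    "('a::euclidean_space \<Rightarrow> 'b::euclidean_space set) \<Rightarrow> 'a \<Rightarrow> 'b \<Rightarrow> 'b \<Rightarrow> 'a set" where
  "limiting_coderivative F x y v = {u. (u, - v) \<in> limiting_normal_cone (gph F) (x, y)}"

(* Unlike infdist, which is 0 on the empty set, this is \<infinity> there (Inf {} = \<infinity> in ereal). *)
definition edist_set :: "'a::metric_space \<Rightarrow> 'a set \<Rightarrow> ereal" where
  "edist_set x A = (INF a\<in>A. ereal (dist x a))"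

definition subregular_on ::
    "('a::euclidean_space \<Rightarrow> 'b::euclidean_space set) \<Rightarrow> 'a \<Rightarrow> 'b \<Rightarrow> real \<Rightarrow> 'a set \<Rightarrow> bool" where
  "subregular_on F xbar ybar \<mu> U \<longleftrightarrow>
     open U \<and> xbar \<in> U \<and>
     (\<forall>x\<in>U. edist_set x (inv_map F ybar) \<le> ereal \<mu> * edist_set ybar (F x))"

definition metrically_subregular ::
    "('a::euclidean_space \<Rightarrow> 'b::euclidean_space set) \<Rightarrow> 'a \<Rightarrow> 'b \<Rightarrow> bool" where
  "metrically_subregular F xbar ybar \<longleftrightarrow>
     (xbar, ybar) \<in> gph F \<and> (\<exists>\<mu>>0. \<exists>U. subregular_on F xbar ybar \<mu> U)"

definition strongly_metrically_subregular ::
    "('a::euclidean_space \<Rightarrow> 'b::euclidean_space set) \<Rightarrow> 'a \<Rightarrow> 'b \<Rightarrow> bool" where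
  "strongly_metrically_subregular F xbar ybar \<longleftrightarrow>
     (xbar, ybar) \<in> gph F \<and>
     (\<exists>\<mu>>0. \<exists>U. subregular_on F xbar ybar \<mu> U \<and> inv_map F ybar \<inter> U = {xbar})"

definition locally_closed_around :: "'a::euclidean_space set \<Rightarrow> 'a \<Rightarrow> bool" where
  "locally_closed_around S z \<longleftrightarrow> (\<exists>e>0. closed (S \<inter> cball z e))"

end

theory Submission
  imports Defs
begin

text \<open>
  The conclusion holds with any vector \<open>u\<close> in place of \<open>- vbar\<close>: strong subregularity makes the
  limiting coderivative surjective. That assumption says that, on the graph close to \<open>(xbar, vbar)\<close>,
  \<open>\<parallel>x - xbar\<parallel> \<le> \<mu> \<parallel>v - vbar\<parallel>\<close> (lemma \<open>strong_subregularity_calmness\<close>). Hence, for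
  \<open>L > \<mu> \<parallel>u\<parallel>\<close>, the function \<open>L \<parallel>v - vbar\<parallel> - u \<bullet> (x - xbar)\<close> has a strict local minimum over the
  graph at \<open>(xbar, vbar)\<close>, and a first-order optimality condition there has the form
  \<open>(u, - d) \<in> N (xbar, vbar)\<close> with \<open>\<parallel>d\<parallel> \<le> L\<close>, which is the claim.

  That condition is obtained by smoothing. Replace \<open>\<parallel>v - vbar\<parallel>\<close> by the function
  \<open>sqrt (\<epsilon>\<^sup>2 + \<parallel>v - vbar\<parallel>\<^sup>2)\<close>. The perturbed problem has a minimizer over a compact
  piece of the graph; by the calmness estimate it lies at distance \<open>O(\<epsilon>)\<close> from \<open>(xbar, vbar)\<close>, and
  there the negative gradient \<open>(u, - d\<^sub>\<epsilon>)\<close> is a regular normal, with \<open>\<parallel>d\<^sub>\<epsilon>\<parallel> \<le> L\<close>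
  (lemma \<open>regular_normals_near_calm_point\<close>). Letting \<open>\<epsilon>\<close> tend to zero along a sequence for which
  \<open>d\<^sub>\<epsilon>\<close> converges gives a limiting normal.
\<close>

text \<open>A quadratic bound on the inner product forces the quotient in the definition of the regular
  normal cone below \<open>c \<parallel>y - z\<parallel>\<close>, which vanishes in the limit: proximal normals are regular.\<close>
lemma proximal_normal_in_regular_normal_cone:
  fixes w z :: "'a::euclidean_space"
  assumes "r > 0" and prox: "\<And>y. y \<in> S \<Longrightarrow> dist y z < r \<Longrightarrow> w \<bullet> (y - z) \<le> c * (norm (y - z))\<^sup>2"
  shows "w \<in> regular_normal_cone S z"
proof -
  have "Limsup (at z within S) (\<lambda>y. ereal (w \<bullet> (y - z) / norm (y - z))) \<le> 0"
    unfolding Limsup_le_iff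
  proof (intro allI impI)
    fix t :: ereal assume "t > 0"
    then obtain q :: real where q: "0 < q" "ereal q < t"
      by (metis ereal_dense2 ereal_less(2))
    have "((\<lambda>y. c * norm (y - z)) \<longlongrightarrow> c * norm (z - z)) (at z within S)"
      by (intro tendsto_intros)
    then have "eventually (\<lambda>y. c * norm (y - z) < q) (at z within S)"
      using q by (auto intro: order_tendstoD(2))
    moreover have "eventually (\<lambda>y. y \<in> S \<and> y \<noteq> z \<and> dist y z < r) (at z within S)"
      using \<open>r > 0\<close> by (auto simp: eventually_at)
    ultimately show "eventually (\<lambda>y. ereal (w \<bullet> (y - z) / norm (y - z)) < t) (at z within S)"
    proof eventually_elim
      case (elim y)
      have "w \<bullet> (y - z) / norm (y - z) \<le> c * norm (y - z)"
        using prox[of y] elim by (simp add: divide_le_eq power2_eq_square mult.assoc)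
      then have "ereal (w \<bullet> (y - z) / norm (y - z)) < ereal q"
        using elim by simp
      then show ?case
        using q(2) by (rule less_trans)
    qed
  qed
  then show ?thesis
    by (simp add: regular_normal_cone_def)
qed

text \<open>In a small enough ball around \<open>xbar\<close> the isolated solution \<open>xbar\<close> is the nearest point of
  \<open>inv_map F ybar\<close>, so the distance on the left of subregularity is \<open>dist x xbar\<close>.\<close>
lemma strong_subregularity_calmness:
  fixes F :: "'a::euclidean_space \<Rightarrow> 'b::euclidean_space set"
  assumes "strongly_metrically_subregular F xbar ybar"
  obtains \<mu> r where "\<mu> > 0" "r > 0"
    "\<And>x y. y \<in> F x \<Longrightarrow> dist x xbar < r \<Longrightarrow> dist x xbar \<le> \<mu> * dist y ybar"
proof -
  obtain \<mu> U where \<mu>: "\<mu> > 0" and U: "open U" "xbar \<in> U"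
    and sub: "\<And>x. x \<in> U \<Longrightarrow> edist_set x (inv_map F ybar) \<le> ereal \<mu> * edist_set ybar (F x)"
    and iso: "inv_map F ybar \<inter> U = {xbar}"
    using assms by (auto simp: strongly_metrically_subregular_def subregular_on_def)
  obtain e where e: "e > 0" "ball xbar e \<subseteq> U"
    using U by (meson openE)
  have "dist x xbar \<le> \<mu> * dist y ybar" if y: "y \<in> F x" and x: "dist x xbar < e / 2" for x y
  proof -
    have "dist x xbar \<le> dist x a" if a: "a \<in> inv_map F ybar" for a
    proof (cases "a = xbar")
      case False
      \<comment> \<open>Any other solution lies outside \<open>U\<close>, hence at distance at least \<open>e / 2\<close> from \<open>x\<close>.\<close>
      then have "a \<notin> ball xbar e"
        using a iso e by blast
      then show ?thesis
        using x dist_triangle[of xbar a x] by (simp add: dist_commute)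
    qed simp
    then have "ereal (dist x xbar) \<le> edist_set x (inv_map F ybar)"
      unfolding edist_set_def by (intro INF_greatest) simp
    also have "\<dots> \<le> ereal \<mu> * edist_set ybar (F x)"
      using x e by (intro sub) (auto simp: dist_commute)
    also have "\<dots> \<le> ereal \<mu> * ereal (dist ybar y)"
      unfolding edist_set_def using y \<mu> by (intro ereal_mult_left_mono INF_lower) auto
    finally show ?thesis
      by (simp add: dist_commute)
  qed
  then show ?thesis
    using that[of \<mu> "e / 2"] \<mu> e by simp
qed

text \<open>The square root is concave, so it lies below its tangent at \<open>\<epsilon>\<^sup>2 + \<parallel>b\<parallel>\<^sup>2\<close>. The remainder
  is quadratic in \<open>c - b\<close>, as needed for a proximal normal.\<close>
lemma sqrt_norm_quadratic_upper_bound: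
  fixes b c :: "'a::real_inner"
  assumes "\<epsilon> > 0"
  defines "s \<equiv> sqrt (\<epsilon>\<^sup>2 + (norm b)\<^sup>2)"
  shows "sqrt (\<epsilon>\<^sup>2 + (norm c)\<^sup>2) \<le> s + (b \<bullet> (c - b)) / s + (norm (c - b))\<^sup>2 / (2 * s)"
proof -
  define t where "t = sqrt (\<epsilon>\<^sup>2 + (norm c)\<^sup>2)"
  have s: "s > 0" "s\<^sup>2 = \<epsilon>\<^sup>2 + (norm b)\<^sup>2"
    using assms by (auto simp: s_def add_pos_nonneg)
  have "t\<^sup>2 = \<epsilon>\<^sup>2 + (norm c)\<^sup>2"
    by (simp add: t_def)
  then have "t\<^sup>2 - s\<^sup>2 = 2 * (b \<bullet> (c - b)) + (norm (c - b))\<^sup>2"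
    unfolding s(2) by (simp add: power2_norm_eq_inner algebra_simps inner_commute)
  moreover have "2 * s * t \<le> s\<^sup>2 + t\<^sup>2"
    by (rule sum_squares_bound)
  ultimately have "2 * s * t \<le> 2 * s * s + 2 * (b \<bullet> (c - b)) + (norm (c - b))\<^sup>2"
    by (simp add: power2_eq_square)
  then have "t \<le> (2 * s * s + 2 * (b \<bullet> (c - b)) + (norm (c - b))\<^sup>2) / (2 * s)"
    using s(1) by (simp add: le_divide_eq mult.commute)
  also have "\<dots> = s + (b \<bullet> (c - b)) / s + (norm (c - b))\<^sup>2 / (2 * s)"
    using s(1) by (simp add: field_simps)
  finally show ?thesis
    by (simp add: t_def)
qed

text \<open>These are the negative gradients of the smoothed penalty function at its minimizers. Their second
  components are bounded independently of \<open>\<eta>\<close>, which makes the passage to the limit possible.\<close>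
lemma regular_normals_near_calm_point:
  fixes S :: "('a::euclidean_space \<times> 'b::euclidean_space) set"
  assumes zbar: "(xbar, ybar) \<in> S" and e: "e > 0" and cl: "closed (S \<inter> cball (xbar, ybar) e)"
    and \<mu>: "\<mu> > 0"
    and calm: "\<And>x y. (x, y) \<in> S \<Longrightarrow> dist (x, y) (xbar, ybar) \<le> e \<Longrightarrow>
                 dist x xbar \<le> \<mu> * dist y ybar"
    and \<eta>: "\<eta> > 0"
  shows "\<exists>z d. z \<in> S \<and> dist z (xbar, ybar) < \<eta> \<and> norm d \<le> norm u * \<mu> + 1 \<and>
               (u, - d) \<in> regular_normal_cone S z"
proof -
  \<comment> \<open>With this \<open>L\<close> the penalty function dominates \<open>\<parallel>y - ybar\<parallel>\<close> on the compact piece of the set.\<close>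
  define L where "L = norm u * \<mu> + 1"
  define \<epsilon> where "\<epsilon> = min \<eta> e / 2 / (L * (1 + \<mu>))"
  define \<sigma> where "\<sigma> = (\<lambda>y. sqrt (\<epsilon>\<^sup>2 + (norm (y - ybar))\<^sup>2))"
  define \<phi> where "\<phi> = (\<lambda>z. L * \<sigma> (snd z) - u \<bullet> (fst z - xbar))"
  define C where "C = S \<inter> cball (xbar, ybar) e"
  have L: "L > 0"
    using \<mu> by (simp add: L_def add_nonneg_pos)
  have \<epsilon>: "\<epsilon> > 0"
    using L \<mu> \<eta> e by (simp add: \<epsilon>_def)
  have \<epsilon>_small: "(1 + \<mu>) * (L * \<epsilon>) = min \<eta> e / 2"
  proof -
    have "L * (1 + \<mu>) \<noteq> 0"
      using L \<mu> by simp
    then have "\<epsilon> * (L * (1 + \<mu>)) = min \<eta> e / 2"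
      unfolding \<epsilon>_def by (rule nonzero_eq_divide_eq[THEN iffD1, OF _ refl])
    then show ?thesis
      by (simp add: mult_ac)
  qed
  have "compact C"
    unfolding compact_eq_bounded_closed using cl bounded_Int[of S] by (auto simp: C_def)
  moreover have "(xbar, ybar) \<in> C"
    using zbar e by (simp add: C_def)
  moreover have "continuous_on C \<phi>"
    unfolding \<phi>_def \<sigma>_def by (intro continuous_intros)
  ultimately obtain z where z: "z \<in> C" and zmin: "\<And>w. w \<in> C \<Longrightarrow> \<phi> z \<le> \<phi> w"
    using continuous_attains_inf[of C \<phi>] by blast
  obtain a b where ab: "z = (a, b)"
    by fastforce
  have calm_ab: "dist a xbar \<le> \<mu> * dist b ybar"
    using z ab by (intro calm) (auto simp: C_def dist_commute)

  \<comment> \<open>Comparing the minimum with the value at \<open>(xbar, ybar)\<close> shows that the minimizer is close to it.\<close>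
  have "\<phi> z \<le> L * \<epsilon>"
    using zmin[OF \<open>(xbar, ybar) \<in> C\<close>] \<epsilon> by (simp add: \<phi>_def \<sigma>_def)
  moreover have "norm (b - ybar) \<le> \<sigma> b"
    unfolding \<sigma>_def by (rule real_le_rsqrt) simp
  then have "L * norm (b - ybar) \<le> L * \<sigma> b"
    using L by simp
  moreover have "u \<bullet> (a - xbar) \<le> norm u * (\<mu> * norm (b - ybar))"
    using norm_cauchy_schwarz[of u "a - xbar"] mult_left_mono[OF calm_ab norm_ge_zero[of u]]
    by (simp add: dist_norm)
  ultimately have b_close: "norm (b - ybar) \<le> L * \<epsilon>"
    by (simp add: \<phi>_def ab L_def algebra_simps)
  have "dist z (xbar, ybar) \<le> dist a xbar + dist b ybar"
    unfolding ab dist_Pair_Pair by (rule sqrt_sum_squares_le_sum) auto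
  also have "\<dots> \<le> (1 + \<mu>) * norm (b - ybar)"
    using calm_ab by (simp add: dist_norm algebra_simps)
  also have "\<dots> \<le> (1 + \<mu>) * (L * \<epsilon>)"
    using b_close \<mu> by (intro mult_left_mono) auto
  finally have z_close: "dist z (xbar, ybar) \<le> min \<eta> e / 2"
    using \<epsilon>_small by simp

  define s where "s = \<sigma> b"
  define d where "d = (L / s) *\<^sub>R (b - ybar)"
  have s: "s > 0"
    using \<epsilon> by (auto simp: s_def \<sigma>_def add_pos_nonneg)
  have "(u, - d) \<in> regular_normal_cone S z"
  proof (rule proximal_normal_in_regular_normal_cone)
    show "e / 2 > 0"
      using e by simp
    fix w assume w: "w \<in> S" "dist w z < e / 2"
    obtain x y where xy: "w = (x, y)"
      by fastforce
    have "w \<in> C"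
      using w z_close dist_triangle[of w "(xbar, ybar)" z] by (auto simp: C_def dist_commute)
    then have "u \<bullet> (x - a) \<le> L * \<sigma> y - L * s"
      using zmin[of w] by (simp add: \<phi>_def ab xy s_def algebra_simps)
    also have "\<dots> \<le> L * (s + ((b - ybar) \<bullet> (y - b)) / s + (norm (y - b))\<^sup>2 / (2 * s)) - L * s"
      using sqrt_norm_quadratic_upper_bound[OF \<epsilon>, of "y - ybar" "b - ybar"] L
      by (simp add: \<sigma>_def s_def)
    also have "\<dots> = d \<bullet> (y - b) + L / (2 * s) * (norm (y - b))\<^sup>2"
      by (simp add: d_def distrib_left)
    finally have "(u, - d) \<bullet> (w - z) \<le> L / (2 * s) * (norm (y - b))\<^sup>2"
      by (simp add: xy ab)
    also have "\<dots> \<le> L / (2 * s) * (norm (w - z))\<^sup>2"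
      using L s by (intro mult_left_mono) (auto simp: xy ab norm_Pair)
    finally show "(u, - d) \<bullet> (w - z) \<le> L / (2 * s) * (norm (w - z))\<^sup>2" .
  qed
  moreover have "norm d \<le> L"
    using \<open>norm (b - ybar) \<le> \<sigma> b\<close> L s
    by (simp add: d_def s_def divide_le_eq)
  moreover have "z \<in> S" "dist z (xbar, ybar) < \<eta>"
    using z z_close \<eta> e by (auto simp: C_def min_def split: if_splits)
  ultimately show ?thesis
    unfolding L_def by blast
qed

text \<open>Compactness of the ball containing all the vectors \<open>d\<close> turns the approximate normals
  of the preceding lemma into an exact limiting normal.\<close>
theorem limiting_coderivative_surjective:
  fixes F :: "'a::euclidean_space \<Rightarrow> 'b::euclidean_space set"
  assumes lc: "locally_closed_around (gph F) (xbar, ybar)"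
    and sms: "strongly_metrically_subregular F xbar ybar"
  shows "\<exists>d. u \<in> limiting_coderivative F xbar ybar d"
proof -
  have zbar: "(xbar, ybar) \<in> gph F"
    using sms by (simp add: strongly_metrically_subregular_def)
  obtain \<mu> r where \<mu>: "\<mu> > 0" and r: "r > 0"
    and calm: "\<And>x y. y \<in> F x \<Longrightarrow> dist x xbar < r \<Longrightarrow> dist x xbar \<le> \<mu> * dist y ybar"
    using strong_subregularity_calmness[OF sms] by blast
  obtain e0 where e0: "e0 > 0" "closed (gph F \<inter> cball (xbar, ybar) e0)"
    using lc by (auto simp: locally_closed_around_def)
  define e where "e = min e0 (r / 2)"
  have e: "e > 0"
    using e0 r by (simp add: e_def)
  have "gph F \<inter> cball (xbar, ybar) e = (gph F \<inter> cball (xbar, ybar) e0) \<inter> cball (xbar, ybar) e"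
    by (auto simp: e_def)
  then have cl: "closed (gph F \<inter> cball (xbar, ybar) e)"
    using e0(2) by (metis closed_Int closed_cball)
  have calm': "dist x xbar \<le> \<mu> * dist y ybar"
    if "(x, y) \<in> gph F" "dist (x, y) (xbar, ybar) \<le> e" for x y
  proof (rule calm)
    show "y \<in> F x"
      using that by (simp add: gph_def)
    have "dist x xbar \<le> e"
      using that(2) dist_fst_le[of "(x, y)" "(xbar, ybar)"] by simp
    then show "dist x xbar < r"
      using r by (auto simp: e_def min_def split: if_splits)
  qed
  define K where "K = norm u * \<mu> + 1"
  have "\<forall>k::nat. \<exists>z d. z \<in> gph F \<and> dist z (xbar, ybar) < inverse (real (Suc k)) \<and>
      norm d \<le> K \<and> (u, - d) \<in> regular_normal_cone (gph F) z"
    unfolding K_def by (intro allI regular_normals_near_calm_point[OF zbar e cl \<mu> calm']) auto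
  then obtain z d where zd: "\<And>k::nat. z k \<in> gph F"
      "\<And>k. dist (z k) (xbar, ybar) < inverse (real (Suc k))"
      "\<And>k. norm (d k) \<le> K" "\<And>k. (u, - d k) \<in> regular_normal_cone (gph F) (z k)"
    by metis
  have "z \<longlonglongrightarrow> (xbar, ybar)"
  proof (rule metric_tendsto_imp_tendsto[OF LIMSEQ_inverse_real_of_nat])
    show "\<forall>\<^sub>F k in sequentially. dist (z k) (xbar, ybar) \<le> dist (inverse (real (Suc k))) 0"
      using zd(2) by (intro always_eventually allI) (simp add: less_imp_le)
  qed
  moreover obtain l and \<rho> :: "nat \<Rightarrow> nat" where \<rho>: "strict_mono \<rho>" "(d \<circ> \<rho>) \<longlonglongrightarrow> l"
    using compact_cball[of 0 K, unfolded compact_def] zd(3) by (metis mem_cball_0)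
  ultimately have "(z \<circ> \<rho>) \<longlonglongrightarrow> (xbar, ybar)"
    by (intro LIMSEQ_subseq_LIMSEQ)
  moreover have "(\<lambda>k. (u, - (d \<circ> \<rho>) k)) \<longlonglongrightarrow> (u, - l)"
    by (intro tendsto_intros \<rho>)
  ultimately have "(u, - l) \<in> limiting_normal_cone (gph F) (xbar, ybar)"
    unfolding limiting_normal_cone_def using zd(1,4)
    by (intro CollectI exI[of _ "z \<circ> \<rho>"] exI[of _ "\<lambda>k. (u, - (d \<circ> \<rho>) k)"]) auto
  then show ?thesis
    by (auto simp: limiting_coderivative_def)
qed

theorem theorem3p1:
  fixes F :: "real ^ 'n \<Rightarrow> (real ^ 'n) set"
    and xbar vbar :: "real ^ 'n"
  assumes "(xbar, vbar) \<in> gph F"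
    and "locally_closed_around (gph F) (xbar, vbar)"
    and "strongly_metrically_subregular F xbar vbar"
  shows "\<exists>d :: real ^ 'n. - vbar \<in> limiting_coderivative F xbar vbar d"
  using assms(2,3) by (rule limiting_coderivative_surjective)

end
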